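(* Let $k$ be a field, $\Pi$ a finite poset and $I^\bullet\in D^b(\Pi)$. If $\sigma\le\tau$ in $\Pi$ and $\mathrm{St}\,\sigma-\mathrm{St}\,\tau\notin\mu\mathrm{supp}^!I^\bullet$, then the linear maps $H^d(I^\bullet)(\sigma\le\tau)$ are isomorphisms for each $d\in\mathbb{Z}$.
   Context: A sheaf on a finite poset is a functor to finite-dimensional $k$-vector spaces; complexes are bounded. $\mathrm{St}\,\pi=\{\tau:\pi\le\tau\}$. For a complex of sheaves $(A^\bullet,\mu^\bullet)$, the cohomology sheaf $H^d(A^\bullet)$ is $\sigma\mapsto\ker\mu^d(\sigma)/\mathrm{im}\,\mu^{d-1}(\sigma)$ with the maps $H^d(A^\bullet)(\sigma\le\tau)$ induced by $A^d(\sigma\le\tau)$. Injective sheaves are the injective objects (finite direct sums of sheaves $[\pi]$ with $[\pi](\sigma)=k$ for $\sigma\le\pi$, $0$ otherwise, identity maps between copies of $k$). A complex of injective sheaves is minimal if in each degree its number of indecomposable summands is least among all bounded injective complexes quasi-isomorphic to it; every bounded complex of sheaves has a minimal injective resolution (a quasi-isomorphism to a minimal injective complex), unique up to isomorphism. The objects of $D^b(\Pi)$ are the minimal complexes of injective sheaves on $\Pi$. A subset $Z\subseteq\Pi$ is locally closed if $a,c\in Z$, $a\le b\le c$ imply $b\in Z$; $i_Z:Z\hookrightarrow\Pi$ is the inclusion. For a sheaf $F$ on $\Pi$, $i_Z^!F$ is the sheaf on $Z$ with $i_Z^!F(\zeta)=\{v\in F(\zeta):F(\zeta\le\tau)(v)=0\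 \forall\tau\in\mathrm{St}_\Pi\zeta\setminus Z\}$. For $p:P\to\{\star\}$ the map from a finite poset to a point, $p_*F=\varprojlim_{\pi\in P}F(\pi)$. For such functors $\varphi$ and an injective complex $I^\bullet$, $\mathcal{I}\varphi I^\bullet$ is the minimal injective resolution of $\varphi(I^\bullet)$. Hypercohomology of an injective complex: $\mathbb{H}^d(I^\bullet)=H^d(\mathcal{I}p_*I^\bullet)$. The discrete $!$-microsupport $\mu\mathrm{supp}^!I^\bullet$ is the set of locally closed $Z\subseteq\Pi$ such that $\mathbb{H}^d(\mathcal{I}i_Z^!I^\bullet)\ne0$ for some $d\in\mathbb{Z}$. *)

theory Defs
  imports "Jordan_Normal_Form.Missing_VectorSpace" "HOL-Algebra.AbelCoset"
begin

text \<open>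
  A finite poset is a finite set \<open>P\<close> in a type of class \<open>order\<close>, with the induced order.
  The field is a ring record \<open>K\<close>, and vector spaces over it are module records satisfying
  the locale \<open>vectorspace\<close>; maps matter only on carriers.

  Quantification over all sheaves has to take place in a fixed type. Wherever sheaves are
  quantified in a definition, their stalks have vectors in \<open>nat \<Rightarrow> 'a\<close>, where \<open>'a\<close> is the
  type of scalars. This loses nothing: this type contains copies of all finite-dimensional
  \<open>K\<close>-vector spaces. Sheaves that are given or constructed have vectors in an arbitrary type.
\<close>

section \<open>Vector spaces\<close>

definition linear_iso ::
    "'a ring \<Rightarrow> ('a, 'v) module \<Rightarrow> ('a, 'w) module \<Rightarrow> ('v \<Rightarrow> 'w) \<Rightarrow> bool" where
  "linear_iso K V W f \<longleftrightarrow> linear_map K V W f \<and> bij_betw f (carrier V) (carrier W)"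

text \<open>The ring multiplication and unit of a module record play no role.\<close>

definition quotient_space :: "('a, 'v) module \<Rightarrow> 'v set \<Rightarrow> ('a, 'v set) module" where
  "quotient_space V W =
    \<lparr>carrier = a_rcosets\<^bsub>V\<^esub> W, mult = undefined, one = undefined,
     zero = W, add = set_add V, smult = (\<lambda>c X. set_add V W (smult V c ` X))\<rparr>"

definition product_space :: "'i set \<Rightarrow> ('i \<Rightarrow> ('a, 'v) module) \<Rightarrow> ('a, 'i \<Rightarrow> 'v) module" where
  "product_space I V =
    \<lparr>carrier = (\<Pi>\<^sub>E i\<in>I. carrier (V i)), mult = undefined, one = undefined,
     zero = (\<lambda>i\<in>I. \<zero>\<^bsub>V i\<^esub>), add = (\<lambda>s t. \<lambda>i\<in>I. s i \<oplus>\<^bsub>V i\<^esub> t i),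
     smult = (\<lambda>c s. \<lambda>i\<in>I. c \<odot>\<^bsub>V i\<^esub> s i)\<rparr>"

section \<open>Sheaves on a poset\<close>

record ('p, 'a, 'v) sheaf =
  stalk :: "'p \<Rightarrow> ('a, 'v) module"
  rmap :: "'p \<Rightarrow> 'p \<Rightarrow> 'v \<Rightarrow> 'v"

definition is_sheaf :: "'a ring \<Rightarrow> 'p::order set \<Rightarrow> ('p, 'a, 'v) sheaf \<Rightarrow> bool" where
  "is_sheaf K P F \<longleftrightarrow>
    (\<forall>\<sigma>\<in>P. vectorspace K (stalk F \<sigma>) \<and> vectorspace.fin_dim K (stalk F \<sigma>)) \<and>
    (\<forall>\<sigma>\<in>P. \<forall>\<tau>\<in>P. \<sigma> \<le> \<tau> \<longrightarrow> linear_map K (stalk F \<sigma>) (stalk F \<tau>) (rmap F \<sigma> \<tau>)) \<and>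
    (\<forall>\<sigma>\<in>P. \<forall>v\<in>carrier (stalk F \<sigma>). rmap F \<sigma> \<sigma> v = v) \<and>
    (\<forall>\<rho>\<in>P. \<forall>\<sigma>\<in>P. \<forall>\<tau>\<in>P. \<rho> \<le> \<sigma> \<and> \<sigma> \<le> \<tau> \<longrightarrow>
      (\<forall>v\<in>carrier (stalk F \<rho>). rmap F \<sigma> \<tau> (rmap F \<rho> \<sigma> v) = rmap F \<rho> \<tau> v))"

definition sheaf_hom ::
    "'a ring \<Rightarrow> 'p::order set \<Rightarrow> ('p, 'a, 'v) sheaf \<Rightarrow> ('p, 'a, 'w) sheaf \<Rightarrow> ('p \<Rightarrow> 'v \<Rightarrow> 'w) \<Rightarrow> bool"
  where
  "sheaf_hom K P F G f \<longleftrightarrow>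
    (\<forall>\<sigma>\<in>P. linear_map K (stalk F \<sigma>) (stalk G \<sigma>) (f \<sigma>)) \<and>
    (\<forall>\<sigma>\<in>P. \<forall>\<tau>\<in>P. \<sigma> \<le> \<tau> \<longrightarrow>
      (\<forall>v\<in>carrier (stalk F \<sigma>). f \<tau> (rmap F \<sigma> \<tau> v) = rmap G \<sigma> \<tau> (f \<sigma> v)))"

definition sheaf_isomorphic ::
    "'a ring \<Rightarrow> 'p::order set \<Rightarrow> ('p, 'a, 'v) sheaf \<Rightarrow> ('p, 'a, 'w) sheaf \<Rightarrow> bool" where
  "sheaf_isomorphic K P F G \<longleftrightarrow>
    (\<exists>f. sheaf_hom K P F G f \<and> (\<forall>\<sigma>\<in>P. linear_iso K (stalk F \<sigma>) (stalk G \<sigma>) (f \<sigma>)))"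

definition injective_sheaf :: "'a ring \<Rightarrow> 'p::order set \<Rightarrow> ('p, 'a, 'v) sheaf \<Rightarrow> bool" where
  "injective_sheaf K P F \<longleftrightarrow> is_sheaf K P F \<and>
    (\<forall>(A :: ('p, 'a, nat \<Rightarrow> 'a) sheaf) (B :: ('p, 'a, nat \<Rightarrow> 'a) sheaf) j f.
      is_sheaf K P A \<and> is_sheaf K P B \<and>
      sheaf_hom K P A B j \<and> (\<forall>\<sigma>\<in>P. inj_on (j \<sigma>) (carrier (stalk A \<sigma>))) \<and>
      sheaf_hom K P A F f \<longrightarrow>
      (\<exists>g. sheaf_hom K P B F g \<and>
        (\<forall>\<sigma>\<in>P. \<forall>v\<in>carrier (stalk A \<sigma>). g \<sigma> (j \<sigma> v) = f \<sigma> v)))"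

text \<open>The indecomposable injective sheaf \<open>[\<pi>]\<close>.\<close>

definition indec_injective :: "'a ring \<Rightarrow> 'p::order \<Rightarrow> ('p, 'a, 'a) sheaf" where
  "indec_injective K \<pi> =
    \<lparr>stalk = (\<lambda>\<sigma>. \<lparr>carrier = (if \<sigma> \<le> \<pi> then carrier K else {\<zero>\<^bsub>K\<^esub>}),
       mult = mult K, one = one K, zero = \<zero>\<^bsub>K\<^esub>, add = add K, smult = mult K\<rparr>),
     rmap = (\<lambda>\<sigma> \<tau> v. if \<tau> \<le> \<pi> then v else \<zero>\<^bsub>K\<^esub>)\<rparr>"

definition direct_sum_sheaf :: "nat \<Rightarrow> (nat \<Rightarrow> ('p, 'a, 'v) sheaf) \<Rightarrow> ('p, 'a, nat \<Rightarrow> 'v) sheaf" where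
  "direct_sum_sheaf n F =
    \<lparr>stalk = (\<lambda>\<sigma>. product_space {..<n} (\<lambda>i. stalk (F i) \<sigma>)),
     rmap = (\<lambda>\<sigma> \<tau> s. \<lambda>i\<in>{..<n}. rmap (F i) \<sigma> \<tau> (s i))\<rparr>"

definition num_summands :: "'a ring \<Rightarrow> 'p::order set \<Rightarrow> ('p, 'a, 'v) sheaf \<Rightarrow> nat" where
  "num_summands K P F =
    (THE n. \<exists>\<pi> :: nat \<Rightarrow> 'p. (\<forall>i<n. \<pi> i \<in> P) \<and>
      sheaf_isomorphic K P F (direct_sum_sheaf n (\<lambda>i. indec_injective K (\<pi> i))))"

section \<open>Complexes of sheaves\<close>

record ('p, 'a, 'v) sheaf_complex =
  obj :: "int \<Rightarrow> ('p, 'a, 'v) sheaf"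
  mu :: "int \<Rightarrow> 'p \<Rightarrow> 'v \<Rightarrow> 'v"

definition bounded_complex :: "'a ring \<Rightarrow> 'p::order set \<Rightarrow> ('p, 'a, 'v) sheaf_complex \<Rightarrow> bool" where
  "bounded_complex K P A \<longleftrightarrow>
    (\<forall>d. is_sheaf K P (obj A d)) \<and>
    (\<forall>d. sheaf_hom K P (obj A d) (obj A (d + 1)) (mu A d)) \<and>
    (\<forall>d. \<forall>\<sigma>\<in>P. \<forall>v\<in>carrier (stalk (obj A d) \<sigma>).
      mu A (d + 1) \<sigma> (mu A d \<sigma> v) = \<zero>\<^bsub>stalk (obj A (d + 2)) \<sigma>\<^esub>) \<and>
    (\<exists>a b. \<forall>d. d < a \<or> b < d \<longrightarrow>
      (\<forall>\<sigma>\<in>P. carrier (stalk (obj A d) \<sigma>) = {\<zero>\<^bsub>stalk (obj A d) \<sigma>\<^esub>}))"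

definition cocycles :: "('p, 'a, 'v) sheaf_complex \<Rightarrow> int \<Rightarrow> 'p \<Rightarrow> 'v set" where
  "cocycles A d \<sigma> = a_kernel (stalk (obj A d) \<sigma>) (stalk (obj A (d + 1)) \<sigma>) (mu A d \<sigma>)"

definition coboundaries :: "('p, 'a, 'v) sheaf_complex \<Rightarrow> int \<Rightarrow> 'p \<Rightarrow> 'v set" where
  "coboundaries A d \<sigma> = mu A (d - 1) \<sigma> ` carrier (stalk (obj A (d - 1)) \<sigma>)"

text \<open>The map induced by \<open>f\<close> on cohomology classes is \<open>z + B \<mapsto> f z + B'\<close>, that is,
  \<open>X \<mapsto> f X + B'\<close> for a class \<open>X\<close>, where \<open>B\<close>, \<open>B'\<close> are the coboundaries.\<close>

definition cohomology :: "('p, 'a, 'v) sheaf_complex \<Rightarrow> int \<Rightarrow> ('p, 'a, 'v set) sheaf" where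
  "cohomology A d =
    \<lparr>stalk = (\<lambda>\<sigma>. quotient_space ((stalk (obj A d) \<sigma>)\<lparr>carrier := cocycles A d \<sigma>\<rparr>)
       (coboundaries A d \<sigma>)),
     rmap = (\<lambda>\<sigma> \<tau> X. set_add (stalk (obj A d) \<tau>) (rmap (obj A d) \<sigma> \<tau> ` X) (coboundaries A d \<tau>))\<rparr>"

definition cohomology_map ::
    "('p, 'a, 'w) sheaf_complex \<Rightarrow> (int \<Rightarrow> 'p \<Rightarrow> 'v \<Rightarrow> 'w) \<Rightarrow> int \<Rightarrow> 'p \<Rightarrow> 'v set \<Rightarrow> 'w set" where
  "cohomology_map B f d \<sigma> X = set_add (stalk (obj B d) \<sigma>) (f d \<sigma> ` X) (coboundaries B d \<sigma>)"

definition complex_hom ::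
    "'a ring \<Rightarrow> 'p::order set \<Rightarrow> ('p, 'a, 'v) sheaf_complex \<Rightarrow> ('p, 'a, 'w) sheaf_complex \<Rightarrow>
      (int \<Rightarrow> 'p \<Rightarrow> 'v \<Rightarrow> 'w) \<Rightarrow> bool" where
  "complex_hom K P A B f \<longleftrightarrow>
    (\<forall>d. sheaf_hom K P (obj A d) (obj B d) (f d)) \<and>
    (\<forall>d. \<forall>\<sigma>\<in>P. \<forall>v\<in>carrier (stalk (obj A d) \<sigma>).
      f (d + 1) \<sigma> (mu A d \<sigma> v) = mu B d \<sigma> (f d \<sigma> v))"

definition quasi_iso ::
    "'a ring \<Rightarrow> 'p::order set \<Rightarrow> ('p, 'a, 'v) sheaf_complex \<Rightarrow> ('p, 'a, 'w) sheaf_complex \<Rightarrow>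
      (int \<Rightarrow> 'p \<Rightarrow> 'v \<Rightarrow> 'w) \<Rightarrow> bool" where
  "quasi_iso K P A B f \<longleftrightarrow> complex_hom K P A B f \<and>
    (\<forall>d. \<forall>\<sigma>\<in>P. linear_iso K (stalk (cohomology A d) \<sigma>) (stalk (cohomology B d) \<sigma>)
      (cohomology_map B f d \<sigma>))"

text \<open>Two complexes are quasi-isomorphic if they are isomorphic in the derived category, where
  every isomorphism is represented by a pair of quasi-isomorphisms into a common complex.\<close>

definition quasi_isomorphic ::
    "'a ring \<Rightarrow> 'p::order set \<Rightarrow> ('p, 'a, 'v) sheaf_complex \<Rightarrow> ('p, 'a, 'w) sheaf_complex \<Rightarrow> bool"
  where
  "quasi_isomorphic K P A B \<longleftrightarrow>
    (\<exists>(C :: ('p, 'a, nat \<Rightarrow> 'a) sheaf_complex) f g.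
      bounded_complex K P C \<and> quasi_iso K P A C f \<and> quasi_iso K P B C g)"

definition injective_complex :: "'a ring \<Rightarrow> 'p::order set \<Rightarrow> ('p, 'a, 'v) sheaf_complex \<Rightarrow> bool" where
  "injective_complex K P I \<longleftrightarrow> bounded_complex K P I \<and> (\<forall>d. injective_sheaf K P (obj I d))"

definition minimal_complex :: "'a ring \<Rightarrow> 'p::order set \<Rightarrow> ('p, 'a, 'v) sheaf_complex \<Rightarrow> bool" where
  "minimal_complex K P I \<longleftrightarrow> injective_complex K P I \<and>
    (\<forall>J :: ('p, 'a, nat \<Rightarrow> 'a) sheaf_complex.
      injective_complex K P J \<and> quasi_isomorphic K P I J \<longrightarrow>
      (\<forall>d. num_summands K P (obj I d) \<le> num_summands K P (obj J d)))"

definition minimal_injective_resolution ::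
    "'a ring \<Rightarrow> 'p::order set \<Rightarrow> ('p, 'a, 'v) sheaf_complex \<Rightarrow> ('p, 'a, 'w) sheaf_complex \<Rightarrow> bool"
  where
  "minimal_injective_resolution K P A J \<longleftrightarrow> minimal_complex K P J \<and> (\<exists>f. quasi_iso K P A J f)"

text \<open>The objects of the bounded derived category.\<close>

definition Db :: "'a ring \<Rightarrow> 'p::order set \<Rightarrow> ('p, 'a, 'v) sheaf_complex set" where
  "Db K P = {I. minimal_complex K P I}"

section \<open>Functors\<close>

definition star :: "'p::order set \<Rightarrow> 'p \<Rightarrow> 'p set" where
  "star P \<pi> = {\<tau>\<in>P. \<pi> \<le> \<tau>}"

definition locally_closed :: "'p::order set \<Rightarrow> 'p set \<Rightarrow> bool" where
  "locally_closed P Z \<longleftrightarrow> Z \<subseteq> P \<and> (\<forall>a\<in>Z. \<forall>c\<in>Z. \<forall>b\<in>P. a \<le> b \<and> b \<le> c \<longrightarrow> b \<in> Z)"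

text \<open>The functor \<open>i\<^sup>!\<close> for the inclusion \<open>i\<close> of a locally closed \<open>Z\<close>; the result is a sheaf on \<open>Z\<close>.\<close>

definition shriek_sheaf :: "'p::order set \<Rightarrow> 'p set \<Rightarrow> ('p, 'a, 'v) sheaf \<Rightarrow> ('p, 'a, 'v) sheaf" where
  "shriek_sheaf P Z F =
    \<lparr>stalk = (\<lambda>\<zeta>. (stalk F \<zeta>)\<lparr>carrier := {v \<in> carrier (stalk F \<zeta>).
       \<forall>\<tau> \<in> star P \<zeta> - Z. rmap F \<zeta> \<tau> v = \<zero>\<^bsub>stalk F \<tau>\<^esub>}\<rparr>),
     rmap = rmap F\<rparr>"

definition shriek :: "'p::order set \<Rightarrow> 'p set \<Rightarrow> ('p, 'a, 'v) sheaf_complex \<Rightarrow> ('p, 'a, 'v) sheaf_complex"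
  where
  "shriek P Z A = \<lparr>obj = (\<lambda>d. shriek_sheaf P Z (obj A d)), mu = mu A\<rparr>"

text \<open>The push-forward to a point; the one-point poset is \<open>UNIV :: unit set\<close>. Its stalk is the
  inverse limit, realised as the space of compatible families.\<close>

definition pushforward_sheaf :: "'p::order set \<Rightarrow> ('p, 'a, 'v) sheaf \<Rightarrow> (unit, 'a, 'p \<Rightarrow> 'v) sheaf" where
  "pushforward_sheaf P F =
    \<lparr>stalk = (\<lambda>_. (product_space P (stalk F))\<lparr>carrier := {s \<in> \<Pi>\<^sub>E \<pi>\<in>P. carrier (stalk F \<pi>).
       \<forall>\<sigma>\<in>P. \<forall>\<tau>\<in>P. \<sigma> \<le> \<tau> \<longrightarrow> rmap F \<sigma> \<tau> (s \<sigma>) = s \<tau>}\<rparr>),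
     rmap = (\<lambda>_ _ s. s)\<rparr>"

definition pushforward ::
    "'p::order set \<Rightarrow> ('p, 'a, 'v) sheaf_complex \<Rightarrow> (unit, 'a, 'p \<Rightarrow> 'v) sheaf_complex" where
  "pushforward P A =
    \<lparr>obj = (\<lambda>d. pushforward_sheaf P (obj A d)), mu = (\<lambda>d _ s. \<lambda>\<pi>\<in>P. mu A d \<pi> (s \<pi>))\<rparr>"

section \<open>Hypercohomology and microsupport\<close>

text \<open>A minimal injective resolution exists and is unique only up to isomorphism, so a property
  of ``the'' resolution is stated for every complex that is one; it does not depend on which.\<close>

definition hypercohomology_nonzero ::
    "'a ring \<Rightarrow> 'p::order set \<Rightarrow> ('p, 'a, 'v) sheaf_complex \<Rightarrow> int \<Rightarrow> bool" where
  "hypercohomology_nonzero K P I d \<longleftrightarrow>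
    (\<forall>L :: (unit, 'a, nat \<Rightarrow> 'a) sheaf_complex.
      minimal_injective_resolution K UNIV (pushforward P I) L \<longrightarrow>
      carrier (stalk (cohomology L d) ()) \<noteq> {\<zero>\<^bsub>stalk (cohomology L d) ()\<^esub>})"

definition microsupport :: "'a ring \<Rightarrow> 'p::order set \<Rightarrow> ('p, 'a, 'v) sheaf_complex \<Rightarrow> 'p set set" where
  "microsupport K P I = {Z. locally_closed P Z \<and>
    (\<forall>J :: ('p, 'a, nat \<Rightarrow> 'a) sheaf_complex.
      minimal_injective_resolution K Z (shriek P Z I) J \<longrightarrow>
      (\<exists>d. hypercohomology_nonzero K Z J d))}"

end

theory Submission
  imports Defs
begin

text \<open>
  If \<open>\<sigma> < \<tau>\<close>, then \<open>\<sigma>\<close> is the minimum of \<open>Z = St \<sigma> - St \<tau>\<close>, so that the global sections of a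
  sheaf on \<open>Z\<close> are its stalk at \<open>\<sigma>\<close>, an exact functor. Hence the hypercohomology of \<open>i\<^sup>! I\<close> is the
  cohomology of its stalk at \<open>\<sigma>\<close>, which is the kernel of \<open>I(\<sigma>) \<rightarrow> I(\<tau>)\<close>. This map is surjective
  since \<open>I\<close> is injective, so if its kernel is acyclic, then it is a quasi-isomorphism.
\<close>

section \<open>Linear maps and quotient spaces\<close>

lemma linear_mapI:
  assumes "vectorspace K V" "vectorspace K W"
    and "\<And>x. x \<in> carrier V \<Longrightarrow> f x \<in> carrier W"
    and "\<And>x y. x \<in> carrier V \<Longrightarrow> y \<in> carrier V \<Longrightarrow> f (x \<oplus>\<^bsub>V\<^esub> y) = f x \<oplus>\<^bsub>W\<^esub> f y"
    and "\<And>c x. c \<in> carrier K \<Longrightarrow> x \<in> carrier V \<Longrightarrow> f (c \<odot>\<^bsub>V\<^esub> x) = c \<odot>\<^bsub>W\<^esub> f x"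
  shows "linear_map K V W f"
  using assms
  by (auto simp: linear_map_def mod_hom_def mod_hom_axioms_def module_hom_def vectorspace_def)

lemma linear_mapD:
  assumes "linear_map K V W f"
  shows "vectorspace K V" "vectorspace K W"
    and "\<And>x. x \<in> carrier V \<Longrightarrow> f x \<in> carrier W"
    and "\<And>x y. x \<in> carrier V \<Longrightarrow> y \<in> carrier V \<Longrightarrow> f (x \<oplus>\<^bsub>V\<^esub> y) = f x \<oplus>\<^bsub>W\<^esub> f y"
    and "\<And>c x. c \<in> carrier K \<Longrightarrow> x \<in> carrier V \<Longrightarrow> f (c \<odot>\<^bsub>V\<^esub> x) = c \<odot>\<^bsub>W\<^esub> f x"
    and "f \<zero>\<^bsub>V\<^esub> = \<zero>\<^bsub>W\<^esub>"
    and "\<And>x y. x \<in> carrier V \<Longrightarrow> y \<in> carrier V \<Longrightarrow> f (x \<ominus>\<^bsub>V\<^esub> y) = f x \<ominus>\<^bsub>W\<^esub> f y"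
proof -
  interpret linear_map K V W f by fact
  show "vectorspace K V" "vectorspace K W" by unfold_locales
  show "\<And>x. x \<in> carrier V \<Longrightarrow> f x \<in> carrier W"
    "\<And>x y. x \<in> carrier V \<Longrightarrow> y \<in> carrier V \<Longrightarrow> f (x \<oplus>\<^bsub>V\<^esub> y) = f x \<oplus>\<^bsub>W\<^esub> f y"
    "\<And>c x. c \<in> carrier K \<Longrightarrow> x \<in> carrier V \<Longrightarrow> f (c \<odot>\<^bsub>V\<^esub> x) = c \<odot>\<^bsub>W\<^esub> f x"
    "f \<zero>\<^bsub>V\<^esub> = \<zero>\<^bsub>W\<^esub>"
    by simp_all
  show "f (x \<ominus>\<^bsub>V\<^esub> y) = f x \<ominus>\<^bsub>W\<^esub> f y" if "x \<in> carrier V" "y \<in> carrier V" for x y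
    using that by (rule T_minus)
qed

lemma vectorspace_abelian_group: "vectorspace K V \<Longrightarrow> abelian_group V"
  by (simp add: vectorspace_def module_def)

lemma subspaceI:
  assumes "vectorspace K V" "W \<subseteq> carrier V" "\<zero>\<^bsub>V\<^esub> \<in> W"
    and "\<And>x y. x \<in> W \<Longrightarrow> y \<in> W \<Longrightarrow> x \<oplus>\<^bsub>V\<^esub> y \<in> W"
    and "\<And>c x. c \<in> carrier K \<Longrightarrow> x \<in> W \<Longrightarrow> c \<odot>\<^bsub>V\<^esub> x \<in> W"
  shows "subspace K W V"
  using assms by (auto simp: subspace_def submodule_def vectorspace_def)

lemma subspaceD:
  assumes "subspace K W V"
  shows "vectorspace K V" "W \<subseteq> carrier V" "\<zero>\<^bsub>V\<^esub> \<in> W"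
    and "\<And>x y. x \<in> W \<Longrightarrow> y \<in> W \<Longrightarrow> x \<oplus>\<^bsub>V\<^esub> y \<in> W"
    and "\<And>c x. c \<in> carrier K \<Longrightarrow> x \<in> W \<Longrightarrow> c \<odot>\<^bsub>V\<^esub> x \<in> W"
  using assms by (auto simp: subspace_def submodule_def)

lemma subspace_abelian_subgroup:
  assumes "subspace K W V"
  shows "abelian_subgroup W V"
proof -
  interpret vectorspace K V by (rule subspaceD[OF assms])
  have "\<ominus>\<^bsub>V\<^esub> x \<in> W" if "x \<in> W" for x
    using that subspaceD[OF assms] smult_minus_1[of x]
    by (metis R.add.inv_closed one_closed subsetD)
  then have "subgroup W (add_monoid V)"
    using subspaceD[OF assms] by (intro add.subgroupI) auto
  then show ?thesis
    by (intro abelian_subgroupI3 additive_subgroupI abelian_group_axioms)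
qed

lemma mem_a_r_coset: "y \<in> W +>\<^bsub>V\<^esub> x \<longleftrightarrow> (\<exists>w\<in>W. y = w \<oplus>\<^bsub>V\<^esub> x)"
  by (auto simp: a_r_coset_def')

lemma carrier_quotient_space: "carrier (quotient_space V W) = (\<lambda>x. W +>\<^bsub>V\<^esub> x) ` carrier V"
  by (auto simp: quotient_space_def A_RCOSETS_def')

lemma zero_quotient_space: "\<zero>\<^bsub>quotient_space V W\<^esub> = W"
  by (simp add: quotient_space_def)

lemma image_coset_add:
  assumes f: "linear_map K V V' f" and W: "subspace K W V" and W': "subspace K W' V'"
    and sub: "f ` W \<subseteq> W'" and x: "x \<in> carrier V"
  shows "set_add V' (f ` (W +>\<^bsub>V\<^esub> x)) W' = W' +>\<^bsub>V'\<^esub> f x"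
proof -
  interpret V': vectorspace K V' by (rule linear_mapD[OF f])
  note fD = linear_mapD[OF f] and WD = subspaceD[OF W] and WD' = subspaceD[OF W']
  have fx: "f x \<in> carrier V'" using fD x by blast
  show ?thesis
  proof (intro equalityI subsetI)
    fix y assume "y \<in> set_add V' (f ` (W +>\<^bsub>V\<^esub> x)) W'"
    then obtain w w' where w: "w \<in> W" "w' \<in> W'" and y: "y = f (w \<oplus>\<^bsub>V\<^esub> x) \<oplus>\<^bsub>V'\<^esub> w'"
      by (auto simp: set_add_def' mem_a_r_coset)
    have c: "w \<in> carrier V" "f w \<in> carrier V'" "w' \<in> carrier V'" "f w \<in> W'"
      using w WD WD' fD sub by auto
    have "y = (w' \<oplus>\<^bsub>V'\<^esub> f w) \<oplus>\<^bsub>V'\<^esub> f x"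
      using y c fx x fD(4) by (simp add: V'.M.add.m_ac)
    moreover have "w' \<oplus>\<^bsub>V'\<^esub> f w \<in> W'" using WD'(4) c w by blast
    ultimately show "y \<in> W' +>\<^bsub>V'\<^esub> f x" by (auto simp: mem_a_r_coset)
  next
    fix y assume "y \<in> W' +>\<^bsub>V'\<^esub> f x"
    then obtain w' where w': "w' \<in> W'" "y = w' \<oplus>\<^bsub>V'\<^esub> f x" by (auto simp: mem_a_r_coset)
    have "w' \<in> carrier V'" using w' WD' by auto
    then have "y = f x \<oplus>\<^bsub>V'\<^esub> w'" using w' fx by (simp add: V'.M.add.m_comm)
    moreover have "x \<in> W +>\<^bsub>V\<^esub> x"
      by (rule abelian_subgroup.a_rcos_self[OF subspace_abelian_subgroup[OF W] x])
    ultimately show "y \<in> set_add V' (f ` (W +>\<^bsub>V\<^esub> x)) W'"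
      using w' by (auto simp: set_add_def')
  qed
qed

text \<open>Moves all operations to representatives, so that the vector space axioms of the quotient
  follow from those of \<open>V\<close>.\<close>

lemma quotient_space_ops:
  assumes W: "subspace K W V"
  shows "\<And>x y. x \<in> carrier V \<Longrightarrow> y \<in> carrier V \<Longrightarrow>
      (W +>\<^bsub>V\<^esub> x) \<oplus>\<^bsub>quotient_space V W\<^esub> (W +>\<^bsub>V\<^esub> y) = W +>\<^bsub>V\<^esub> (x \<oplus>\<^bsub>V\<^esub> y)"
    and "\<And>c x. c \<in> carrier K \<Longrightarrow> x \<in> carrier V \<Longrightarrow>
      c \<odot>\<^bsub>quotient_space V W\<^esub> (W +>\<^bsub>V\<^esub> x) = W +>\<^bsub>V\<^esub> (c \<odot>\<^bsub>V\<^esub> x)"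
    and "\<zero>\<^bsub>quotient_space V W\<^esub> = W +>\<^bsub>V\<^esub> \<zero>\<^bsub>V\<^esub>"
proof -
  interpret vectorspace K V by (rule subspaceD[OF W])
  interpret sg: abelian_subgroup W V by (rule subspace_abelian_subgroup[OF W])
  note WD = subspaceD[OF W]
  show "(W +>\<^bsub>V\<^esub> x) \<oplus>\<^bsub>quotient_space V W\<^esub> (W +>\<^bsub>V\<^esub> y) = W +>\<^bsub>V\<^esub> (x \<oplus>\<^bsub>V\<^esub> y)"
    if "x \<in> carrier V" "y \<in> carrier V" for x y
    using sg.a_rcos_sum[OF that] by (simp add: quotient_space_def)
  show "\<zero>\<^bsub>quotient_space V W\<^esub> = W +>\<^bsub>V\<^esub> \<zero>\<^bsub>V\<^esub>"
    using sg.a_rcos_const[OF WD(3)] by (simp add: quotient_space_def)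
  show "c \<odot>\<^bsub>quotient_space V W\<^esub> (W +>\<^bsub>V\<^esub> x) = W +>\<^bsub>V\<^esub> (c \<odot>\<^bsub>V\<^esub> x)"
    if c: "c \<in> carrier K" and x: "x \<in> carrier V" for c x
  proof -
    \<comment> \<open>Multiplication by \<open>c\<close> is a linear endomorphism preserving
      \<open>W\<close>, so the rule for images of cosets applies to it with \<open>V' = V\<close>
      and \<open>W' = W\<close>.\<close>
    have "linear_map K V V (smult V c)"
      using c by (intro linear_mapI WD(1))
        (auto simp: smult_r_distr smult_assoc1[symmetric] m_comm)
    moreover have "smult V c ` W \<subseteq> W" using WD(5) c by blast
    ultimately have eq: "set_add V (smult V c ` (W +>\<^bsub>V\<^esub> x)) W = W +>\<^bsub>V\<^esub> (c \<odot>\<^bsub>V\<^esub> x)"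
      using W x by (intro image_coset_add) auto
    \<comment> \<open>The definition of \<open>quotient_space\<close> adds \<open>W\<close> on the
      left, the rule for images on the right; inside the carrier the two sums agree.\<close>
    have "W +>\<^bsub>V\<^esub> x \<subseteq> carrier V"
      using WD(2) x by (auto simp: mem_a_r_coset)
    then have "set_add V W (smult V c ` (W +>\<^bsub>V\<^esub> x)) = set_add V (smult V c ` (W +>\<^bsub>V\<^esub> x)) W"
      using c WD(2) by (force simp: set_add_def' M.add.m_comm subset_iff)
    with eq show ?thesis by (simp add: quotient_space_def)
  qed
qed

lemma vectorspace_quotient_space:
  assumes W: "subspace K W V"
  shows "vectorspace K (quotient_space V W)"
proof -
  interpret vectorspace K V by (rule subspaceD[OF W])
  note q = quotient_space_ops[OF W]
  show ?thesis
  proof (rule vs_criteria)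
    show "\<forall>v\<in>carrier (quotient_space V W). \<exists>n\<in>carrier (quotient_space V W).
        v \<oplus>\<^bsub>quotient_space V W\<^esub> n = \<zero>\<^bsub>quotient_space V W\<^esub>"
    proof
      fix v assume "v \<in> carrier (quotient_space V W)"
      then obtain x where x: "x \<in> carrier V" "v = W +>\<^bsub>V\<^esub> x"
        by (auto simp: carrier_quotient_space)
      then have "v \<oplus>\<^bsub>quotient_space V W\<^esub> (W +>\<^bsub>V\<^esub> (\<ominus>\<^bsub>V\<^esub> x)) = \<zero>\<^bsub>quotient_space V W\<^esub>"
        by (simp add: q M.r_neg)
      with x show "\<exists>n\<in>carrier (quotient_space V W).
          v \<oplus>\<^bsub>quotient_space V W\<^esub> n = \<zero>\<^bsub>quotient_space V W\<^esub>"
        by (auto simp: carrier_quotient_space)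
    qed
  qed (auto simp: carrier_quotient_space q M.add.m_ac smult_l_distr smult_r_distr smult_assoc1
      field_axioms)
qed

text \<open>If \<open>f\<close> is onto and the preimage of \<open>W'\<close> is \<open>W\<close>,
  then the kernel of the composite of \<open>f\<close> with the projection to the quotient by
  \<open>W'\<close> is \<open>W\<close>. In the application \<open>f\<close> is a restriction map
  between spaces of cocycles.\<close>

lemma linear_iso_quotient_space:
  assumes f: "linear_map K V V' f" and W: "subspace K W V" and W': "subspace K W' V'"
    and sub: "f ` W \<subseteq> W'"
    and inj: "\<And>x. x \<in> carrier V \<Longrightarrow> f x \<in> W' \<Longrightarrow> x \<in> W"
    and surj: "carrier V' \<subseteq> f ` carrier V"
  shows "linear_iso K (quotient_space V W) (quotient_space V' W') (\<lambda>X. set_add V' (f ` X) W')"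
proof -
  interpret V: vectorspace K V by (rule linear_mapD[OF f])
  interpret V': vectorspace K V' by (rule linear_mapD[OF f])
  interpret W: abelian_subgroup W V by (rule subspace_abelian_subgroup[OF W])
  interpret W': abelian_subgroup W' V' by (rule subspace_abelian_subgroup[OF W'])
  note fD = linear_mapD[OF f]
  note im = image_coset_add[OF f W W' sub]
  note q = quotient_space_ops[OF W] and q' = quotient_space_ops[OF W']
  have lin: "linear_map K (quotient_space V W) (quotient_space V' W') (\<lambda>X. set_add V' (f ` X) W')"
    by (rule linear_mapI[OF vectorspace_quotient_space[OF W] vectorspace_quotient_space[OF W']])
      (auto simp: carrier_quotient_space im q q' fD)
  have "inj_on (\<lambda>X. set_add V' (f ` X) W') (carrier (quotient_space V W))"
  proof (rule inj_onI)
    fix X Y assume "X \<in> carrier (quotient_space V W)" "Y \<in> carrier (quotient_space V W)"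
      and eq: "set_add V' (f ` X) W' = set_add V' (f ` Y) W'"
    then obtain x y where x: "x \<in> carrier V" "X = W +>\<^bsub>V\<^esub> x" and y: "y \<in> carrier V" "Y = W +>\<^bsub>V\<^esub> y"
      by (auto simp: carrier_quotient_space)
    have fx: "f x \<in> carrier V'" "f y \<in> carrier V'" using x y fD by auto
    have "W' +>\<^bsub>V'\<^esub> f x = W' +>\<^bsub>V'\<^esub> f y" using eq x y im by simp
    then have "f x \<in> W' +>\<^bsub>V'\<^esub> f y" using W'.a_rcos_self[OF fx(1)] by simp
    then have "f x \<ominus>\<^bsub>V'\<^esub> f y \<in> W'" using W'.a_rcos_module_imp[OF fx(2)] by (simp add: a_minus_def)
    then have "x \<ominus>\<^bsub>V\<^esub> y \<in> W" using inj x y by (simp add: fD(7))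
    then have "x \<in> W +>\<^bsub>V\<^esub> y" using W.a_rcos_module_rev[OF y(1) x(1)] by (simp add: a_minus_def)
    then show "X = Y" using W.a_repr_independence'[OF _ y(1)] x y by auto
  qed
  moreover have "(\<lambda>X. set_add V' (f ` X) W') ` carrier (quotient_space V W)
      = carrier (quotient_space V' W')"
    using surj fD(3) by (force simp: carrier_quotient_space im image_image)
  ultimately show ?thesis using lin by (simp add: linear_iso_def bij_betw_def)
qed

section \<open>Cocycles and coboundaries\<close>

lemma mem_cocycles:
  "v \<in> cocycles A d \<sigma> \<longleftrightarrow>
    v \<in> carrier (stalk (obj A d) \<sigma>) \<and> mu A d \<sigma> v = \<zero>\<^bsub>stalk (obj A (d + 1)) \<sigma>\<^esub>"
  by (simp add: cocycles_def a_kernel_def kernel_def)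

text \<open>The definition indexes from the left end of three consecutive degrees; here they are
  centred at \<open>d\<close>, as \<open>coboundaries\<close> reaches degree \<open>d\<close> from
  \<open>d - 1\<close>.\<close>

lemma bounded_complexD:
  assumes A: "bounded_complex K P A" and \<sigma>: "\<sigma> \<in> P"
  shows "linear_map K (stalk (obj A d) \<sigma>) (stalk (obj A (d + 1)) \<sigma>) (mu A d \<sigma>)"
    and "linear_map K (stalk (obj A (d - 1)) \<sigma>) (stalk (obj A d) \<sigma>) (mu A (d - 1) \<sigma>)"
    and "v \<in> carrier (stalk (obj A (d - 1)) \<sigma>) \<Longrightarrow>
      mu A d \<sigma> (mu A (d - 1) \<sigma> v) = \<zero>\<^bsub>stalk (obj A (d + 1)) \<sigma>\<^esub>"
proof -
  have lin: "linear_map K (stalk (obj A d) \<sigma>) (stalk (obj A (d + 1)) \<sigma>) (mu A d \<sigma>)" for d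
    using A \<sigma> by (simp add: bounded_complex_def sheaf_hom_def)
  show "linear_map K (stalk (obj A d) \<sigma>) (stalk (obj A (d + 1)) \<sigma>) (mu A d \<sigma>)"
    by (rule lin)
  show "linear_map K (stalk (obj A (d - 1)) \<sigma>) (stalk (obj A d) \<sigma>) (mu A (d - 1) \<sigma>)"
    using lin[of "d - 1"] by simp
  have "\<forall>d. \<forall>v\<in>carrier (stalk (obj A d) \<sigma>).
      mu A (d + 1) \<sigma> (mu A d \<sigma> v) = \<zero>\<^bsub>stalk (obj A (d + 2)) \<sigma>\<^esub>"
    using A \<sigma> by (simp add: bounded_complex_def)
  from this[rule_format, of v "d - 1"]
  show "v \<in> carrier (stalk (obj A (d - 1)) \<sigma>) \<Longrightarrow>
      mu A d \<sigma> (mu A (d - 1) \<sigma> v) = \<zero>\<^bsub>stalk (obj A (d + 1)) \<sigma>\<^esub>"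
    by (simp add: add.commute)
qed

lemma subspace_cocycles:
  assumes "bounded_complex K P A" "\<sigma> \<in> P"
  shows "subspace K (cocycles A d \<sigma>) (stalk (obj A d) \<sigma>)"
proof -
  interpret linear_map K "stalk (obj A d) \<sigma>" "stalk (obj A (d + 1)) \<sigma>" "mu A d \<sigma>"
    by (rule bounded_complexD[OF assms])
  show ?thesis
    by (rule subspaceI) (auto simp: mem_cocycles V.vectorspace_axioms)
qed

lemma subspace_coboundaries:
  assumes "bounded_complex K P A" "\<sigma> \<in> P"
  shows "subspace K (coboundaries A d \<sigma>) ((stalk (obj A d) \<sigma>)\<lparr>carrier := cocycles A d \<sigma>\<rparr>)"
proof -
  interpret U: vectorspace K "stalk (obj A (d - 1)) \<sigma>"
    by (rule linear_mapD[OF bounded_complexD(2)[OF assms]])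
  interpret f: linear_map K "stalk (obj A (d - 1)) \<sigma>" "stalk (obj A d) \<sigma>" "mu A (d - 1) \<sigma>"
    by (rule bounded_complexD[OF assms])
  have vs: "vectorspace K ((stalk (obj A d) \<sigma>)\<lparr>carrier := cocycles A d \<sigma>\<rparr>)"
    using f.W.subspace_is_vs[OF subspace_cocycles[OF assms]] .
  have closed: "x \<oplus>\<^bsub>stalk (obj A d) \<sigma>\<^esub> y \<in> coboundaries A d \<sigma>"
    if "x \<in> coboundaries A d \<sigma>" "y \<in> coboundaries A d \<sigma>" for x y
    using that by (auto simp: coboundaries_def f.T_add[symmetric] simp del: f.T_add)
  have smult: "c \<odot>\<^bsub>stalk (obj A d) \<sigma>\<^esub> x \<in> coboundaries A d \<sigma>"
    if "c \<in> carrier K" "x \<in> coboundaries A d \<sigma>" for c x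
    using that by (auto simp: coboundaries_def f.T_smult[symmetric] simp del: f.T_smult)
  have zero: "\<zero>\<^bsub>stalk (obj A d) \<sigma>\<^esub> \<in> coboundaries A d \<sigma>"
    unfolding coboundaries_def by (rule image_eqI[where x = "\<zero>\<^bsub>stalk (obj A (d - 1)) \<sigma>\<^esub>"]) simp_all
  have "coboundaries A d \<sigma> \<subseteq> cocycles A d \<sigma>"
    by (auto simp: mem_cocycles coboundaries_def bounded_complexD(3)[OF assms])
  then show ?thesis
    by (intro subspaceI[OF vs]) (simp_all add: closed smult zero)
qed

lemma stalk_cohomology:
  "stalk (cohomology A d) \<sigma> =
    quotient_space ((stalk (obj A d) \<sigma>)\<lparr>carrier := cocycles A d \<sigma>\<rparr>) (coboundaries A d \<sigma>)"
  by (simp add: cohomology_def)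

text \<open>Vanishing is expressed as having one element: this passes along a bijection without
  comparing zeros.\<close>

lemma is_singleton_cohomology:
  assumes A: "bounded_complex K P A" "\<sigma> \<in> P" and sub: "cocycles A d \<sigma> \<subseteq> coboundaries A d \<sigma>"
  shows "is_singleton (carrier (stalk (cohomology A d) \<sigma>))"
proof -
  note W = subspace_coboundaries[OF A, of d]
  interpret W: abelian_subgroup "coboundaries A d \<sigma>" "(stalk (obj A d) \<sigma>)\<lparr>carrier := cocycles A d \<sigma>\<rparr>"
    by (rule subspace_abelian_subgroup[OF W])
  have "carrier (stalk (cohomology A d) \<sigma>) = (\<lambda>x. coboundaries A d \<sigma>) ` cocycles A d \<sigma>"
    unfolding stalk_cohomology carrier_quotient_space
    using W.a_rcos_const sub by (intro image_cong) auto
  moreover have "cocycles A d \<sigma> \<noteq> {}" using subspaceD(3)[OF subspace_cocycles[OF A]] by blast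
  ultimately show ?thesis by (auto simp: is_singleton_def)
qed

text \<open>Here \<open>A\<close> is not assumed to be a complex: \<open>quasi_iso\<close> contains all the linear algebra
  that is needed.\<close>

lemma cocycle_coboundary_of_quasi_iso:
  assumes f: "quasi_iso K P A B f" and \<sigma>: "\<sigma> \<in> P"
    and zero: "mu A (d - 1) \<sigma> \<zero>\<^bsub>stalk (obj A (d - 1)) \<sigma>\<^esub> = \<zero>\<^bsub>stalk (obj A d) \<sigma>\<^esub>"
    and sing: "is_singleton (carrier (stalk (cohomology B d) \<sigma>))"
    and v: "v \<in> cocycles A d \<sigma>"
  shows "v \<in> coboundaries A d \<sigma>"
proof -
  let ?S = "(stalk (obj A d) \<sigma>)\<lparr>carrier := cocycles A d \<sigma>\<rparr>" and ?W = "coboundaries A d \<sigma>"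
  have vs: "vectorspace K (stalk (obj A d) \<sigma>)" for d
    using f \<sigma> linear_mapD(1) unfolding quasi_iso_def complex_hom_def sheaf_hom_def by blast
  interpret V: vectorspace K "stalk (obj A d) \<sigma>" by (rule vs)
  have "\<zero>\<^bsub>stalk (obj A (d - 1)) \<sigma>\<^esub> \<in> carrier (stalk (obj A (d - 1)) \<sigma>)"
    by (rule abelian_monoid.zero_closed[OF abelian_group.axioms(1)[OF vectorspace_abelian_group[OF vs]]])
  then have 0: "\<zero>\<^bsub>stalk (obj A d) \<sigma>\<^esub> \<in> ?W"
    using zero unfolding coboundaries_def by (metis imageI)
  have iso: "linear_iso K (stalk (cohomology A d) \<sigma>) (stalk (cohomology B d) \<sigma>)
      (cohomology_map B f d \<sigma>)"
    using f \<sigma> by (simp add: quasi_iso_def)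
  \<comment> \<open>A linear isomorphism carries the vector space structure of its source, so the
    zero of this quotient, which is the set \<open>?W\<close>, is one of its elements.\<close>
  interpret H: vectorspace K "stalk (cohomology A d) \<sigma>"
    using iso unfolding linear_iso_def by (blast intro: linear_mapD(1))
  have "is_singleton (carrier (stalk (cohomology A d) \<sigma>))"
    using iso sing bij_betw_same_card unfolding linear_iso_def is_singleton_altdef by metis
  moreover have "?W \<in> carrier (stalk (cohomology A d) \<sigma>)"
    using H.M.zero_closed by (simp add: stalk_cohomology zero_quotient_space)
  moreover have "?W +>\<^bsub>?S\<^esub> v \<in> carrier (stalk (cohomology A d) \<sigma>)"
    using v by (auto simp: stalk_cohomology carrier_quotient_space)
  ultimately have "?W +>\<^bsub>?S\<^esub> v = ?W" by (metis is_singletonE singletonD)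
  \<comment> \<open>Membership of \<open>v\<close> in its own coset comes from writing
    \<open>v\<close> as zero plus \<open>v\<close>, with zero in \<open>?W\<close>.\<close>
  moreover have "v \<in> ?W +>\<^bsub>?S\<^esub> v"
    using 0 v by (force simp: mem_a_r_coset mem_cocycles)
  ultimately show ?thesis by simp
qed

section \<open>Restriction maps of injective sheaves\<close>

text \<open>A copy of the field inside \<open>nat => 'a\<close>, namely the constant functions:
  \<open>injective_sheaf\<close> tests extension only for sheaves with vectors in that type.\<close>

definition scalar_line :: "'a ring \<Rightarrow> ('a, nat \<Rightarrow> 'a) module" where
  "scalar_line K =
    \<lparr>carrier = (\<lambda>c _. c) ` carrier K, mult = undefined, one = undefined,
     zero = (\<lambda>_. \<zero>\<^bsub>K\<^esub>), add = (\<lambda>u v n. u n \<oplus>\<^bsub>K\<^esub> v n), smult = (\<lambda>c v n. c \<otimes>\<^bsub>K\<^esub> v n)\<rparr>"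

text \<open>The constant sheaf on the star of \<pi>, extended by zero; it represents the functor
  taking a sheaf to its stalk at \<pi>. Stars are upward closed, so a nonzero vector never meets a
  zero stalk and the identity serves as every restriction map.\<close>

definition star_sheaf :: "'a ring \<Rightarrow> 'p::order \<Rightarrow> ('p, 'a, nat \<Rightarrow> 'a) sheaf" where
  "star_sheaf K \<pi> =
    \<lparr>stalk = (\<lambda>\<rho>. if \<pi> \<le> \<rho> then scalar_line K else (scalar_line K)\<lparr>carrier := {\<lambda>_. \<zero>\<^bsub>K\<^esub>}\<rparr>),
     rmap = (\<lambda>_ _ v. v)\<rparr>"

lemma scalar_line_simps [simp]:
  "carrier (scalar_line K) = (\<lambda>c _. c) ` carrier K"
  "\<zero>\<^bsub>scalar_line K\<^esub> = (\<lambda>_. \<zero>\<^bsub>K\<^esub>)"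
  "u \<oplus>\<^bsub>scalar_line K\<^esub> v = (\<lambda>n. u n \<oplus>\<^bsub>K\<^esub> v n)"
  "c \<odot>\<^bsub>scalar_line K\<^esub> v = (\<lambda>n. c \<otimes>\<^bsub>K\<^esub> v n)"
  by (simp_all add: scalar_line_def)

lemma vectorspace_scalar_line:
  assumes "field K"
  shows "vectorspace K (scalar_line K)"
proof -
  interpret field K by fact
  have neg: "\<exists>b\<in>carrier K. (\<lambda>n::nat. a \<oplus>\<^bsub>K\<^esub> b) = (\<lambda>_. \<zero>\<^bsub>K\<^esub>)" if "a \<in> carrier K" for a
    using that by (intro bexI[of _ "\<ominus>\<^bsub>K\<^esub> a"]) (auto simp: r_neg)
  show ?thesis
    by (rule vs_criteria) (auto simp: assms m_assoc add.m_ac l_distr r_distr neg)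
qed

lemma fin_dim_scalar_line:
  assumes "field K"
  shows "vectorspace.fin_dim K (scalar_line K)"
proof -
  interpret field K by fact
  interpret V: vectorspace K "scalar_line K" by (rule vectorspace_scalar_line[OF assms])
  let ?e = "\<lambda>_::nat. \<one>\<^bsub>K\<^esub>"
  have e: "{?e} \<subseteq> carrier (scalar_line K)" by auto
  have sub: "submodule K (V.span {?e}) (scalar_line K)" by (rule V.span_is_submodule[OF e])
  have "?e \<in> V.span {?e}" using V.in_own_span[OF e] by simp
  then have "c \<odot>\<^bsub>scalar_line K\<^esub> ?e \<in> V.span {?e}" if "c \<in> carrier K" for c
    using submodule.smult_closed[OF sub that] by blast
  then have "carrier (scalar_line K) \<subseteq> V.span {?e}" by auto
  moreover have "V.span {?e} \<subseteq> carrier (scalar_line K)" by (rule submodule.subset[OF sub])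
  ultimately show ?thesis
    unfolding V.fin_dim_def using e by (intro exI[of _ "{?e}"]) auto
qed

lemma star_sheaf_stalk:
  assumes "field K"
  shows "vectorspace K (stalk (star_sheaf K \<pi>) \<rho>)"
    and "vectorspace.fin_dim K (stalk (star_sheaf K \<pi>) \<rho>)"
proof -
  interpret field K by fact
  let ?Z = "(scalar_line K)\<lparr>carrier := {\<lambda>_. \<zero>\<^bsub>K\<^esub>}\<rparr>"
  have Z: "vectorspace K ?Z"
    by (rule vs_criteria) (auto simp: assms)
  interpret Z: vectorspace K ?Z by (rule Z)
  have "submodule K (Z.span {}) ?Z" by (rule Z.span_is_submodule) simp
  then have "Z.span {} = carrier ?Z"
    using submodule.subset submodule.zero_closed by fastforce
  then have fd: "Z.fin_dim" unfolding Z.fin_dim_def by blast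
  show "vectorspace K (stalk (star_sheaf K \<pi>) \<rho>)"
    and "vectorspace.fin_dim K (stalk (star_sheaf K \<pi>) \<rho>)"
    using Z fd vectorspace_scalar_line[OF assms] fin_dim_scalar_line[OF assms]
    by (simp_all add: star_sheaf_def)
qed

text \<open>Serves twice: \<sigma> = \<tau> gives the restriction maps of a star sheaf, and \<rho> =
  \<rho>' gives the inclusion of the star sheaf of \<tau> into that of \<sigma>.\<close>

lemma star_sheaf_mono:
  assumes "field K" "\<sigma> \<le> \<tau>" "\<rho> \<le> \<rho>'"
  shows "linear_map K (stalk (star_sheaf K \<tau>) \<rho>) (stalk (star_sheaf K \<sigma>) \<rho>') (\<lambda>v. v)"
proof -
  interpret field K by fact
  show ?thesis
    using assms(2,3) order_trans[of \<sigma> \<tau> \<rho>'] order_trans[of \<tau> \<rho> \<rho>']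
    by (intro linear_mapI star_sheaf_stalk assms(1)) (auto simp: star_sheaf_def split: if_splits)
qed

lemma is_sheaf_star_sheaf: "field K \<Longrightarrow> is_sheaf K P (star_sheaf K \<pi>)"
  using star_sheaf_mono[of K \<pi> \<pi>] star_sheaf_stalk[of K \<pi>]
  by (auto simp: is_sheaf_def star_sheaf_def)

text \<open>A vector over \<open>\<tau>\<close> is a map to \<open>F\<close> from the constant sheaf on the star of \<open>\<tau>\<close>; injectivity
  of \<open>F\<close> extends it to the star of \<open>\<sigma>\<close>.\<close>

lemma injective_sheaf_rmap_surj:
  assumes K: "field K" and F: "injective_sheaf K P F"
    and \<sigma>: "\<sigma> \<in> P" and \<tau>: "\<tau> \<in> P" and le: "\<sigma> \<le> \<tau>"
  shows "carrier (stalk F \<tau>) \<subseteq> rmap F \<sigma> \<tau> ` carrier (stalk F \<sigma>)"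
proof
  interpret field K by fact
  fix w assume w: "w \<in> carrier (stalk F \<tau>)"
  let ?A = "star_sheaf K \<tau>" and ?B = "star_sheaf K \<sigma>" and ?j = "\<lambda>(_::'b) (v::nat \<Rightarrow> 'a). v"
  \<comment> \<open>The map corresponding to \<open>w\<close>: a constant function with value c goes
    to c times the restriction of \<open>w\<close>. Evaluation at 0 reads off c.\<close>
  let ?f = "\<lambda>\<rho> v. if \<tau> \<le> \<rho> then v 0 \<odot>\<^bsub>stalk F \<rho>\<^esub> rmap F \<tau> \<rho> w else \<zero>\<^bsub>stalk F \<rho>\<^esub>"
  have sh: "is_sheaf K P F" using F by (simp add: injective_sheaf_def)
  have vs: "vectorspace K (stalk F \<rho>)" if "\<rho> \<in> P" for \<rho> using sh that by (simp add: is_sheaf_def)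
  have lin: "linear_map K (stalk F \<rho>) (stalk F \<rho>') (rmap F \<rho> \<rho>')"
    if "\<rho> \<in> P" "\<rho>' \<in> P" "\<rho> \<le> \<rho>'" for \<rho> \<rho>' using sh that by (simp add: is_sheaf_def)
  have comp: "rmap F \<rho> \<rho>' (rmap F \<tau> \<rho> w) = rmap F \<tau> \<rho>' w"
    if "\<rho> \<in> P" "\<rho>' \<in> P" "\<tau> \<le> \<rho>" "\<rho> \<le> \<rho>'" for \<rho> \<rho>'
    using sh that w \<tau> by (auto simp: is_sheaf_def)
  have fhom: "sheaf_hom K P ?A F ?f"
    unfolding sheaf_hom_def
  proof (intro conjI ballI impI)
    fix \<rho> assume \<rho>: "\<rho> \<in> P"
    interpret F: vectorspace K "stalk F \<rho>" by (rule vs[OF \<rho>])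
    have "rmap F \<tau> \<rho> w \<in> carrier (stalk F \<rho>)" if "\<tau> \<le> \<rho>"
      using linear_mapD(3)[OF lin[OF \<tau> \<rho> that]] w .
    then show "linear_map K (stalk ?A \<rho>) (stalk F \<rho>) (?f \<rho>)"
      by (intro linear_mapI star_sheaf_stalk K F.vectorspace_axioms)
        (auto simp: star_sheaf_def F.smult_l_distr F.smult_assoc1)
  next
    fix \<rho> \<rho>' v assume \<rho>: "\<rho> \<in> P" "\<rho>' \<in> P" "\<rho> \<le> \<rho>'" and v: "v \<in> carrier (stalk ?A \<rho>)"
    interpret r: linear_map K "stalk F \<rho>" "stalk F \<rho>'" "rmap F \<rho> \<rho>'" by (rule lin[OF \<rho>])
    show "?f \<rho>' (rmap ?A \<rho> \<rho>' v) = rmap F \<rho> \<rho>' (?f \<rho> v)"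
    proof (cases "\<tau> \<le> \<rho>")
      case True
      then have "rmap F \<tau> \<rho> w \<in> carrier (stalk F \<rho>)"
        using linear_mapD(3)[OF lin[OF \<tau> \<rho>(1)]] w by blast
      then show ?thesis
        using True \<rho> v comp order_trans[OF True \<rho>(3)] by (auto simp: star_sheaf_def)
    next
      case False
      \<comment> \<open>Off the star of \<tau> the vector \<open>v\<close> is zero, so both sides
        vanish even if \<rho>' lies in that star.\<close>
      have "rmap F \<tau> \<rho>' w \<in> carrier (stalk F \<rho>')" if "\<tau> \<le> \<rho>'"
        using linear_mapD(3)[OF lin[OF \<tau> \<rho>(2) that]] w .
      then show ?thesis using False v by (auto simp: star_sheaf_def)
    qed
  qed
  have jhom: "sheaf_hom K P ?A ?B ?j"
    unfolding sheaf_hom_def using star_sheaf_mono[OF K le] by (auto simp: star_sheaf_def)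
  have "\<exists>g. sheaf_hom K P ?B F g \<and> (\<forall>\<rho>\<in>P. \<forall>v\<in>carrier (stalk ?A \<rho>). g \<rho> (?j \<rho> v) = ?f \<rho> v)"
    by (rule F[unfolded injective_sheaf_def, THEN conjunct2, rule_format])
      (intro conjI is_sheaf_star_sheaf[OF K] fhom jhom ballI inj_onI)
  then obtain g where g: "sheaf_hom K P ?B F g"
    and gf: "\<And>\<rho> v. \<rho> \<in> P \<Longrightarrow> v \<in> carrier (stalk ?A \<rho>) \<Longrightarrow> g \<rho> v = ?f \<rho> v" by blast
  \<comment> \<open>The unit lives on the whole star of \<sigma>. Its image under \<open>g\<close>
    at \<sigma> restricts to its image at \<tau>, where \<open>g\<close> agrees with
    \<open>?f\<close> and gives \<open>w\<close>.\<close>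
  let ?e = "\<lambda>_::nat. \<one>\<^bsub>K\<^esub>"
  interpret F\<tau>: vectorspace K "stalk F \<tau>" by (rule vs[OF \<tau>])
  have e: "?e \<in> carrier (stalk ?B \<sigma>)" "?e \<in> carrier (stalk ?A \<tau>)" by (auto simp: star_sheaf_def)
  have "linear_map K (stalk ?B \<sigma>) (stalk F \<sigma>) (g \<sigma>)"
    using g \<sigma> by (simp add: sheaf_hom_def)
  from linear_mapD(3)[OF this e(1)] have "g \<sigma> ?e \<in> carrier (stalk F \<sigma>)" .
  moreover have "rmap F \<sigma> \<tau> (g \<sigma> ?e) = g \<tau> (rmap ?B \<sigma> \<tau> ?e)"
    using g \<sigma> \<tau> le e(1) by (simp add: sheaf_hom_def)
  moreover have "g \<tau> (rmap ?B \<sigma> \<tau> ?e) = w"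
    using gf[OF \<tau> e(2)] w sh \<tau> by (simp add: star_sheaf_def is_sheaf_def)
  ultimately show "w \<in> rmap F \<sigma> \<tau> ` carrier (stalk F \<sigma>)" by (metis imageI)
qed

section \<open>The long exact sequence\<close>

text \<open>By \<open>surj\<close>, the restriction maps form a surjection of complexes of vector
  spaces; \<open>acyclic\<close> says that its kernel complex is exact. The connecting maps are
  replaced by a direct diagram chase.\<close>

lemma linear_iso_cohomology_rmap:
  assumes A: "bounded_complex K P A" and \<sigma>: "\<sigma> \<in> P" and \<tau>: "\<tau> \<in> P" and le: "\<sigma> \<le> \<tau>"
    and surj: "\<And>d. carrier (stalk (obj A d) \<tau>) \<subseteq> rmap (obj A d) \<sigma> \<tau> ` carrier (stalk (obj A d) \<sigma>)"
    and acyclic: "\<And>d v. v \<in> cocycles A d \<sigma> \<Longrightarrow> rmap (obj A d) \<sigma> \<tau> v = \<zero>\<^bsub>stalk (obj A d) \<tau>\<^esub> \<Longrightarrow>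
      \<exists>u \<in> carrier (stalk (obj A (d - 1)) \<sigma>).
        rmap (obj A (d - 1)) \<sigma> \<tau> u = \<zero>\<^bsub>stalk (obj A (d - 1)) \<tau>\<^esub> \<and> v = mu A (d - 1) \<sigma> u"
  shows "linear_iso K (stalk (cohomology A d) \<sigma>) (stalk (cohomology A d) \<tau>)
    (rmap (cohomology A d) \<sigma> \<tau>)"
proof -
  let ?S = "\<lambda>d. stalk (obj A d) \<sigma>" and ?T = "\<lambda>d. stalk (obj A d) \<tau>"
  let ?r = "\<lambda>d. rmap (obj A d) \<sigma> \<tau>"
  have rlin: "linear_map K (?S d) (?T d) (?r d)" for d
    using A \<sigma> \<tau> le by (simp add: bounded_complex_def is_sheaf_def)
  have comm: "mu A d \<tau> (?r d v) = ?r (d + 1) (mu A d \<sigma> v)" if "v \<in> carrier (?S d)" for d v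
    using A \<sigma> \<tau> le that by (simp add: bounded_complex_def sheaf_hom_def)
  have comm': "mu A (d - 1) \<tau> (?r (d - 1) v) = ?r d (mu A (d - 1) \<sigma> v)"
    if "v \<in> carrier (?S (d - 1))" for d v
    using comm[OF that] by simp
  note S = bounded_complexD[OF A \<sigma>] and T = bounded_complexD[OF A \<tau>]
  interpret S: vectorspace K "?S d" by (rule linear_mapD[OF rlin])
  interpret S1: vectorspace K "?S (d - 1)" by (rule linear_mapD[OF rlin])
  interpret T: vectorspace K "?T d" by (rule linear_mapD[OF rlin])
  interpret S2: vectorspace K "?S (d + 1)" by (rule linear_mapD[OF rlin])
  let ?V = "(?S d)\<lparr>carrier := cocycles A d \<sigma>\<rparr>" and ?V' = "(?T d)\<lparr>carrier := cocycles A d \<tau>\<rparr>"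
  have cocycle_rmap: "?r d v \<in> cocycles A d \<tau>" if "v \<in> cocycles A d \<sigma>" for v
    using that comm[of v d] linear_mapD(3)[OF rlin] linear_mapD(6)[OF rlin[of "d + 1"]]
    by (auto simp: mem_cocycles)
  have "linear_iso K (quotient_space ?V (coboundaries A d \<sigma>)) (quotient_space ?V' (coboundaries A d \<tau>))
      (\<lambda>X. set_add ?V' (?r d ` X) (coboundaries A d \<tau>))"
  proof (rule linear_iso_quotient_space)
    show "linear_map K ?V ?V' (?r d)"
      using S.subspace_is_vs[OF subspace_cocycles[OF A \<sigma>]]
        T.subspace_is_vs[OF subspace_cocycles[OF A \<tau>]] cocycle_rmap linear_mapD(4,5)[OF rlin]
      by (intro linear_mapI) (auto simp: mem_cocycles)
    show "subspace K (coboundaries A d \<sigma>) ?V" "subspace K (coboundaries A d \<tau>) ?V'"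
      by (rule subspace_coboundaries[OF A \<sigma>], rule subspace_coboundaries[OF A \<tau>])
    show "?r d ` coboundaries A d \<sigma> \<subseteq> coboundaries A d \<tau>"
      using comm'[symmetric] linear_mapD(3)[OF rlin[of "d - 1"]]
      by (auto simp: coboundaries_def)
    show "x \<in> coboundaries A d \<sigma>"
      if x: "x \<in> carrier ?V" and rx: "?r d x \<in> coboundaries A d \<tau>" for x
    proof -
      have xc: "x \<in> cocycles A d \<sigma>" "x \<in> carrier (?S d)" using x by (auto simp: mem_cocycles)
      obtain t where t: "t \<in> carrier (?T (d - 1))" "?r d x = mu A (d - 1) \<tau> t"
        using rx by (auto simp: coboundaries_def)
      \<comment> \<open>Lifting the primitive \<open>t\<close> of the image of \<open>x\<close> to
        \<sigma> and subtracting the coboundary of the lift moves \<open>x\<close> into the kernel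
        complex.\<close>
      obtain s where s: "s \<in> carrier (?S (d - 1))" "t = ?r (d - 1) s"
        using surj t by blast
      let ?m = "mu A (d - 1) \<sigma> s"
      have m: "?m \<in> carrier (?S d)" using linear_mapD(3)[OF S(2)] s by blast
      have eq: "?r d x = ?r d ?m" using t s comm' by simp
      have "?r d (x \<ominus>\<^bsub>?S d\<^esub> ?m) = \<zero>\<^bsub>?T d\<^esub>"
        using linear_mapD(7)[OF rlin xc(2) m] eq linear_mapD(3)[OF rlin m] by simp
      moreover have "x \<ominus>\<^bsub>?S d\<^esub> ?m \<in> cocycles A d \<sigma>"
        using xc m linear_mapD(7)[OF S(1) xc(2) m] S(3)[OF s(1)] by (simp add: mem_cocycles)
      ultimately obtain u where u: "u \<in> carrier (?S (d - 1))" "x \<ominus>\<^bsub>?S d\<^esub> ?m = mu A (d - 1) \<sigma> u"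
        using acyclic by blast
      have "x = (x \<ominus>\<^bsub>?S d\<^esub> ?m) \<oplus>\<^bsub>?S d\<^esub> ?m"
        using xc m by (simp add: a_minus_def S.M.add.m_assoc S.M.l_neg)
      also have "\<dots> = mu A (d - 1) \<sigma> (u \<oplus>\<^bsub>?S (d - 1)\<^esub> s)"
        using u s linear_mapD(4)[OF S(2)] by simp
      finally show ?thesis
        using S1.M.add.m_closed[OF u(1) s(1)] unfolding coboundaries_def by blast
    qed
    show "carrier ?V' \<subseteq> ?r d ` carrier ?V"
    proof
      fix t assume "t \<in> carrier ?V'"
      then have t: "t \<in> carrier (?T d)" "mu A d \<tau> t = \<zero>\<^bsub>?T (d + 1)\<^esub>" by (auto simp: mem_cocycles)
      \<comment> \<open>A lift of the cocycle \<open>t\<close> need not be a cocycle, but its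
        differential is a cocycle of the kernel complex in degree \<open>d + 1\<close>. A primitive
        \<open>u\<close> there corrects the lift without changing its restriction.\<close>
      obtain s where s: "s \<in> carrier (?S d)" "t = ?r d s" using surj t by blast
      let ?m = "mu A d \<sigma> s"
      have m: "?m \<in> carrier (?S (d + 1))" using linear_mapD(3)[OF S(1)] s by blast
      have "?r (d + 1) ?m = \<zero>\<^bsub>?T (d + 1)\<^esub>" using comm s t by simp
      moreover have "?m \<in> cocycles A (d + 1) \<sigma>"
        using m S(3)[of s "d + 1"] s by (simp add: mem_cocycles)
      ultimately obtain u where u: "u \<in> carrier (?S d)" "?r d u = \<zero>\<^bsub>?T d\<^esub>" "?m = mu A d \<sigma> u"
        using acyclic[of ?m "d + 1"] by auto
      have "?r d (s \<ominus>\<^bsub>?S d\<^esub> u) = t"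
        using linear_mapD(7)[OF rlin s(1) u(1)] s u t by (simp add: a_minus_def)
      moreover have "s \<ominus>\<^bsub>?S d\<^esub> u \<in> cocycles A d \<sigma>"
        using s u m linear_mapD(7)[OF S(1) s(1) u(1)] by (simp add: mem_cocycles)
      ultimately show "t \<in> ?r d ` carrier ?V" by auto
    qed
  qed
  \<comment> \<open>\<open>cohomology\<close> adds in the full stalk and the quotient lemma in the
    space of cocycles; the two records share their addition.\<close>
  moreover have "set_add ?V' = set_add (?T d)" by (simp add: set_add_def set_mult_def fun_eq_iff)
  ultimately show ?thesis by (simp add: cohomology_def)
qed

section \<open>Global sections on a poset with a minimum\<close>

text \<open>Evaluation at the minimum is inverse to spreading a vector by restriction. A cocycle at
  \<sigma> spreads to a global cocycle, and evaluating a global primitive at \<sigma> gives a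
  primitive of the original cocycle.\<close>

lemma cocycles_subset_coboundaries_of_acyclic_pushforward:
  fixes L :: "(unit, 'a, 'w) sheaf_complex"
  assumes J: "bounded_complex K Z J" and \<sigma>: "\<sigma> \<in> Z" and min: "\<And>\<rho>. \<rho> \<in> Z \<Longrightarrow> \<sigma> \<le> \<rho>"
    and g: "quasi_iso K UNIV (pushforward Z J) L g"
    and L: "is_singleton (carrier (stalk (cohomology L d) ()))"
  shows "cocycles J d \<sigma> \<subseteq> coboundaries J d \<sigma>"
proof
  fix w assume w: "w \<in> cocycles J d \<sigma>"
  \<comment> \<open>Functoriality makes this family compatible; it is defined on all of
    \<open>Z\<close> because \<sigma> lies below every element.\<close>
  let ?s = "\<lambda>\<rho>\<in>Z. rmap (obj J d) \<sigma> \<rho> w"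
  have wc: "w \<in> carrier (stalk (obj J d) \<sigma>)" using w by (simp add: mem_cocycles)
  have sh: "is_sheaf K Z (obj J d)" for d using J by (simp add: bounded_complex_def)
  have rlin: "linear_map K (stalk (obj J d) \<sigma>) (stalk (obj J d) \<rho>) (rmap (obj J d) \<sigma> \<rho>)"
    if "\<rho> \<in> Z" for \<rho> d using sh[of d] \<sigma> min that by (simp add: is_sheaf_def)
  have "?s \<in> carrier (stalk (obj (pushforward Z J) d) ())"
    using linear_mapD(3)[OF rlin wc] sh[of d] wc min \<sigma>
    by (auto simp: pushforward_def pushforward_sheaf_def is_sheaf_def)
  moreover have "mu J d \<rho> (rmap (obj J d) \<sigma> \<rho> w) = \<zero>\<^bsub>stalk (obj J (d + 1)) \<rho>\<^esub>" if "\<rho> \<in> Z" for \<rho>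
    using J w that \<sigma> min linear_mapD(6)[OF rlin[OF that, of "d + 1"]]
    by (simp add: bounded_complex_def sheaf_hom_def mem_cocycles)
  ultimately have "?s \<in> cocycles (pushforward Z J) d ()"
    by (auto simp: mem_cocycles pushforward_def pushforward_sheaf_def product_space_def)
  moreover have "mu (pushforward Z J) (d - 1) () \<zero>\<^bsub>stalk (obj (pushforward Z J) (d - 1)) ()\<^esub>
      = \<zero>\<^bsub>stalk (obj (pushforward Z J) d) ()\<^esub>"
    using linear_mapD(6)[OF bounded_complexD(2)[OF J]]
    by (auto simp: pushforward_def pushforward_sheaf_def product_space_def)
  ultimately have "?s \<in> coboundaries (pushforward Z J) d ()"
    using L by (intro cocycle_coboundary_of_quasi_iso[OF g]) auto
  then obtain t where t: "t \<in> (\<Pi>\<^sub>E \<rho>\<in>Z. carrier (stalk (obj J (d - 1)) \<rho>))"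
    and eq: "?s = (\<lambda>\<rho>\<in>Z. mu J (d - 1) \<rho> (t \<rho>))"
    by (auto simp: coboundaries_def pushforward_def pushforward_sheaf_def)
  \<comment> \<open>Restriction from \<sigma> to itself is the identity.\<close>
  have "w = ?s \<sigma>" using sh[of d] \<sigma> wc by (simp add: is_sheaf_def)
  also have "\<dots> = mu J (d - 1) \<sigma> (t \<sigma>)" using eq \<sigma> by simp
  finally show "w \<in> coboundaries J d \<sigma>"
    using t \<sigma> by (auto simp: coboundaries_def)
qed

section \<open>From the microsupport to the restriction maps\<close>

text \<open>A difference of two upward closed sets. This rules out failure of local closedness as
  the reason why the set is absent from the microsupport.\<close>

lemma locally_closed_star_diff: "locally_closed P (star P \<sigma> - star P \<tau>)"
  by (auto simp: locally_closed_def star_def intro: order_trans)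

theorem theorem6p4:
  fixes K :: "'a ring" and P :: "'p::order set"
    and I :: "('p, 'a, 'v) sheaf_complex" and \<sigma> \<tau> :: 'p
  assumes "field K" and "finite P" and "I \<in> Db K P"
    and "\<sigma> \<in> P" and "\<tau> \<in> P" and "\<sigma> \<le> \<tau>"
    and "star P \<sigma> - star P \<tau> \<notin> microsupport K P I"
  shows "\<forall>d. linear_iso K (stalk (cohomology I d) \<sigma>) (stalk (cohomology I d) \<tau>)
    (rmap (cohomology I d) \<sigma> \<tau>)"
proof
  fix d
  note \<sigma> = \<open>\<sigma> \<in> P\<close> and \<tau> = \<open>\<tau> \<in> P\<close> and le = \<open>\<sigma> \<le> \<tau>\<close>
  let ?Z = "star P \<sigma> - star P \<tau>"
  have I: "bounded_complex K P I" and inj: "\<And>d. injective_sheaf K P (obj I d)"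
    using assms(3) by (auto simp: Db_def minimal_complex_def injective_complex_def)
  have sh: "is_sheaf K P (obj I d)" for d using I by (simp add: bounded_complex_def)
  \<comment> \<open>\<open>microsupport\<close> quantifies universally over resolutions, so absence
    from it yields a resolution \<open>J\<close> all of whose hypercohomology vanishes.\<close>
  obtain J :: "('p, 'a, nat \<Rightarrow> 'a) sheaf_complex" where
    J: "minimal_injective_resolution K ?Z (shriek P ?Z I) J"
    and hyp: "\<And>d. \<not> hypercohomology_nonzero K ?Z J d"
    using assms(7) locally_closed_star_diff unfolding microsupport_def by blast
  obtain f where f: "quasi_iso K ?Z (shriek P ?Z I) J f"
    using J by (auto simp: minimal_injective_resolution_def)
  have Jc: "bounded_complex K ?Z J"
    using J by (auto simp: minimal_injective_resolution_def minimal_complex_def injective_complex_def)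
  \<comment> \<open>Exactness of the kernel complex of the restriction from \<sigma> to
    \<tau>.\<close>
  have acyclic: "\<exists>u \<in> carrier (stalk (obj I (e - 1)) \<sigma>).
      rmap (obj I (e - 1)) \<sigma> \<tau> u = \<zero>\<^bsub>stalk (obj I (e - 1)) \<tau>\<^esub> \<and> v = mu I (e - 1) \<sigma> u"
    if v: "v \<in> cocycles I e \<sigma>" and rv: "rmap (obj I e) \<sigma> \<tau> v = \<zero>\<^bsub>stalk (obj I e) \<tau>\<^esub>" for e v
  proof (cases "\<sigma> = \<tau>")
    \<comment> \<open>Here \<open>?Z\<close> is empty and has no stalk at \<sigma>, but the
      restriction is the identity and its kernel is zero.\<close>
    case True
    interpret U: vectorspace K "stalk (obj I (e - 1)) \<sigma>"
      using sh \<sigma> by (simp add: is_sheaf_def)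
    interpret m: linear_map K "stalk (obj I (e - 1)) \<sigma>" "stalk (obj I e) \<sigma>" "mu I (e - 1) \<sigma>"
      by (rule bounded_complexD[OF I \<sigma>])
    have "v = \<zero>\<^bsub>stalk (obj I e) \<sigma>\<^esub>"
      using sh[of e] True \<sigma> v rv by (simp add: is_sheaf_def mem_cocycles)
    moreover have "rmap (obj I (e - 1)) \<sigma> \<sigma> \<zero>\<^bsub>stalk (obj I (e - 1)) \<sigma>\<^esub> = \<zero>\<^bsub>stalk (obj I (e - 1)) \<sigma>\<^esub>"
      using sh \<sigma> U.M.zero_closed unfolding is_sheaf_def by blast
    ultimately show ?thesis
      using True U.M.zero_closed by (metis m.T0_is_0)
  next
    case False
    have \<sigma>Z: "\<sigma> \<in> ?Z" using False order.antisym[OF le] \<sigma> by (auto simp: star_def)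
    \<comment> \<open>Again a negated universal statement: for each degree \<open>e\<close> it
      yields a resolution \<open>L\<close> of the global sections with zero cohomology in that
      degree.\<close>
    obtain L :: "(unit, 'a, nat \<Rightarrow> 'a) sheaf_complex" and g where
      g: "quasi_iso K UNIV (pushforward ?Z J) L g"
      and L: "carrier (stalk (cohomology L e) ()) = {\<zero>\<^bsub>stalk (cohomology L e) ()\<^esub>}"
      using hyp[of e] by (auto simp: hypercohomology_nonzero_def minimal_injective_resolution_def)
    have "cocycles J e \<sigma> \<subseteq> coboundaries J e \<sigma>"
      by (rule cocycles_subset_coboundaries_of_acyclic_pushforward[OF Jc \<sigma>Z _ g])
        (auto simp: star_def L is_singleton_def)
    then have HJ: "is_singleton (carrier (stalk (cohomology J e) \<sigma>))"
      by (rule is_singleton_cohomology[OF Jc \<sigma>Z])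
    \<comment> \<open>The part of the star of \<sigma> outside \<open>?Z\<close> is the star of
      \<tau>, so all these restrictions factor through \<tau>. Hence the stalk of
      \<open>shriek_sheaf\<close> at \<sigma> is the kernel of the restriction to \<tau>.\<close>
    have "rmap (obj I e) \<sigma> \<rho> v = \<zero>\<^bsub>stalk (obj I e) \<rho>\<^esub>" if "\<rho> \<in> star P \<sigma> - ?Z" for \<rho>
    proof -
      have \<rho>: "\<rho> \<in> P" "\<tau> \<le> \<rho>" using that by (auto simp: star_def)
      have "linear_map K (stalk (obj I e) \<tau>) (stalk (obj I e) \<rho>) (rmap (obj I e) \<tau> \<rho>)"
        using sh[of e] \<rho> \<tau> by (simp add: is_sheaf_def)
      from linear_mapD(6)[OF this] show ?thesis
        using sh[of e] \<rho> \<sigma> \<tau> le v rv unfolding is_sheaf_def mem_cocycles by metis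
    qed
    then have "v \<in> cocycles (shriek P ?Z I) e \<sigma>"
      using v by (simp add: mem_cocycles shriek_def shriek_sheaf_def)
    \<comment> \<open>The stalk of \<open>J\<close> at \<sigma> is exact in degree \<open>e\<close>,
      and the quasi-isomorphism \<open>f\<close> carries this back to the kernel complex.\<close>
    then have "v \<in> coboundaries (shriek P ?Z I) e \<sigma>"
      using linear_mapD(6)[OF bounded_complexD(2)[OF I \<sigma>]] HJ
      by (intro cocycle_coboundary_of_quasi_iso[OF f \<sigma>Z])
        (auto simp: shriek_def shriek_sheaf_def)
    \<comment> \<open>At \<tau> the defining condition of the stalk says that the primitive
      restricts to zero there.\<close>
    moreover have "\<tau> \<in> star P \<sigma> - ?Z" using \<tau> le by (simp add: star_def)
    ultimately show ?thesis
      by (auto simp: coboundaries_def shriek_def shriek_sheaf_def)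
  qed
  show "linear_iso K (stalk (cohomology I d) \<sigma>) (stalk (cohomology I d) \<tau>)
      (rmap (cohomology I d) \<sigma> \<tau>)"
    using injective_sheaf_rmap_surj[OF \<open>field K\<close> inj \<sigma> \<tau> le] acyclic
    by (rule linear_iso_cohomology_rmap[OF I \<sigma> \<tau> le])
qed

end
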